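(* Let $s\ge2$ and $t\ge1$ be integers and let $\epsilon\in(0,1/3]$ and $r>0$ be real numbers. Let $k_1,\dots,k_s$ be positive integers and for $i\in[s]$ let $\mathcal F_i\subset\binom{[n]}{k_i}$ be shifted families such that $|F_1\cap\dots\cap F_s|\ge t$ for all $F_1\in\mathcal F_1,\dots,F_s\in\mathcal F_s$. Then there exist juntas $\mathcal J_1\subset\binom{[n]}{k_1},\dots,\mathcal J_s\subset\binom{[n]}{k_s}$ with center $[j]$ such that for each $i$ $$|\mathcal F_i\setminus\mathcal J_i|\le\Big(\frac{k_i}{n}\Big)^r\binom{n}{k_i},$$ and for any $F_1\in\mathcal J_1,\dots,F_s\in\mathcal J_s$ we have $|F_1\cap\dots\cap F_s|\ge t$, provided one of the following holds: (i) $j:=\max_{i\in[s]}\Big\{\frac{4\sigma}{\epsilon^2k_i}\Big(r\log\frac{\sigma}{(1-\epsilon)k_i}+\log\frac8{\epsilon^2}\Big),\ \frac{\sigma r}{\epsilon k_i}\Big\}$ and $n\ge(1-\epsilon)^{-1}\sigma$, where $\sigma:=\sum_{i=1}^s\frac{k_i}{s-1}$; (ii) $j:=\max\Big\{\frac8{\epsilon^2}\Big(r\log\frac{s}{(s-1)(1-\epsilon)}+\log\frac8{\epsilon^2}\Big),\ \frac{rs}{\epsilon(s-1)}\Big\}$ and $n\ge\max_{i\in[s]}(1-\epsilon)^{-1}\frac{s}{s-1}k_i$; (iii) $j:=3sr$ and $n\ge 2e^2k$, where $k:=\max_{i\in[s]}k_i$.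
   Context: Logarithms without a base are natural. $[m]=\{1,\dots,m\}$; for a real $j$, $[j]$ denotes $\{1,\dots,\lfloor j\rfloor\}$. $\binom{[n]}{k}$ is the family of $k$-subsets of $[n]$. A family $\mathcal F\subset\binom{[n]}{k}$ is shifted if whenever $\{x_1<\dots<x_k\}\in\mathcal F$ and $\{y_1<\dots<y_k\}\subset[n]$ with $y_i\le x_i$ for all $i$, then $\{y_1,\dots,y_k\}\in\mathcal F$. A family $\mathcal J\subset\binom{[n]}{k}$ is a junta with center $[j]$ if there is $\mathcal J^*\subset2^{[j]}$ with $\mathcal J=\{F\in\binom{[n]}{k}: F\cap[j]\in\mathcal J^*\}$. *)

theory Defs
  imports Complex_Main "HOL-Library.Ramsey"
begin

text \<open>
  The \<open>k\<close>-subsets of \<open>[n]\<close> are \<open>nsets {1..n} k\<close>.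
  For a real number \<open>j\<close>, \<open>[j]\<close> is the set of positive integers up to the floor of \<open>j\<close>
  (empty when \<open>j < 1\<close>). It need not be contained in \<open>[n]\<close>.
\<close>

definition upto_real :: "real \<Rightarrow> nat set" where
  "upto_real j = {1..nat \<lfloor>j\<rfloor>}"

text \<open>
  For a finite set \<open>X\<close> with elements \<open>x\<^sub>1 < \<dots> < x\<^sub>k\<close>,
  \<open>sorted_list_of_set X ! i\<close> is \<open>x\<^sub>i\<^sub>+\<^sub>1\<close>, as list indices start at 0.
\<close>

definition shifted :: "nat \<Rightarrow> nat \<Rightarrow> nat set set \<Rightarrow> bool" where
  "shifted n k \<F> \<longleftrightarrow>
     \<F> \<subseteq> nsets {1..n} k \<and>
     (\<forall>X\<in>\<F>. \<forall>Y\<in>nsets {1..n} k.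
        (\<forall>i<k. sorted_list_of_set Y ! i \<le> sorted_list_of_set X ! i) \<longrightarrow> Y \<in> \<F>)"

definition junta :: "nat \<Rightarrow> nat \<Rightarrow> nat set \<Rightarrow> nat set set \<Rightarrow> bool" where
  "junta n k C \<J> \<longleftrightarrow>
     (\<exists>\<J>'. \<J>' \<subseteq> Pow C \<and> \<J> = {F \<in> nsets {1..n} k. F \<inter> C \<in> \<J>'})"

definition cross_intersecting :: "nat \<Rightarrow> nat \<Rightarrow> (nat \<Rightarrow> nat set set) \<Rightarrow> bool" where
  "cross_intersecting s t \<F> \<longleftrightarrow>
     (\<forall>F. (\<forall>i\<in>{1..s}. F i \<in> \<F> i) \<longrightarrow> card (\<Inter>i\<in>{1..s}. F i) \<ge> t)"

end

theory Submission
  imports Defs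
begin

text \<open>
  Put \<open>\<alpha> i = k i / \<sigma>\<close> in the first case and \<open>\<alpha> i = (s - 1) / s\<close> in the other two, so that the
  \<open>\<alpha> i\<close> add up to \<open>s - 1\<close>. In shifted cross-\<open>t\<close>-intersecting families, any choice of members has
  a prefix \<open>{1..l}\<close> on which their sizes add up to at least \<open>(s - 1) * l + t\<close> (Frankl); conversely
  such a prefix forces \<open>t\<close> common elements. If each member has fewer than \<open>\<alpha> i * l\<close> elements in
  \<open>{1..l}\<close> for all \<open>l > j\<close>, then that prefix has \<open>l \<le> j\<close>. Hence the juntas generated by the traces
  on \<open>[j]\<close> of these light members remain cross-\<open>t\<close>-intersecting. The members that are not light
  are counted by a maximal inequality for \<open>card (F \<inter> {1..l}) / l\<close> together with a Chernoff bound.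
\<close>

section \<open>Order statistics and exchanges in shifted families\<close>

text \<open>Trades order statistics for the counts \<open>card (X \<inter> {..v})\<close>, which are
  easy to follow when a single element is replaced.\<close>

lemma nth_sorted_list_of_set_le_iff:
  fixes X :: "nat set"
  assumes "finite X" "i < card X"
  shows "sorted_list_of_set X ! i \<le> v \<longleftrightarrow> i < card (X \<inter> {..v})"
proof -
  define xs where "xs = sorted_list_of_set X"
  have xs: "set xs = X" "sorted xs" "distinct xs" "length xs = card X"
    using assms by (auto simp: xs_def)
  have "i < card (X \<inter> {..v})" if "xs ! i \<le> v"
  proof -
    have "set (take (Suc i) xs) \<subseteq> X \<inter> {..v}"
    proof
      fix x assume "x \<in> set (take (Suc i) xs)"
      then obtain l where l: "l < Suc i" "l < length xs" "x = xs ! l"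
        by (auto simp: in_set_conv_nth)
      then have "xs ! l \<le> xs ! i"
        using xs assms by (intro sorted_nth_mono) auto
      with l that xs show "x \<in> X \<inter> {..v}" by auto
    qed
    then have "card (set (take (Suc i) xs)) \<le> card (X \<inter> {..v})"
      using assms by (intro card_mono) auto
    then show ?thesis
      using xs assms by (simp add: distinct_card)
  qed
  moreover have "card (X \<inter> {..v}) \<le> i" if "v < xs ! i"
  proof -
    have "X \<inter> {..v} \<subseteq> set (take i xs)"
    proof
      fix x assume x: "x \<in> X \<inter> {..v}"
      then obtain l where l: "l < length xs" "x = xs ! l"
        using xs by (auto simp: in_set_conv_nth)
      have "l < i"
      proof (rule ccontr)
        assume "\<not> l < i"
        then have "xs ! i \<le> xs ! l"
          using xs l by (intro sorted_nth_mono) auto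
        with l that x show False by auto
      qed
      with l show "x \<in> set (take i xs)"
        by (auto simp: in_set_conv_nth intro!: exI[of _ l])
    qed
    then have "card (X \<inter> {..v}) \<le> card (set (take i xs))"
      by (intro card_mono) auto
    also have "\<dots> \<le> i"
      using card_length[of "take i xs"] by simp
    finally show ?thesis .
  qed
  ultimately show ?thesis
    unfolding xs_def[symmetric] by (meson leD not_le_imp_less)
qed

text \<open>Moving an element down decreases none of the counts
  \<open>card (X \<inter> {..v})\<close>, so no order statistic grows. Apart from containment in
  \<open>nsets {1..n} k\<close>, this is the only consequence of shiftedness used below.\<close>

lemma shifted_exchange:
  assumes sh: "shifted n k \<F>" and X: "X \<in> \<F>"
    and z: "z \<in> X" and y: "y \<notin> X" "1 \<le> y" "y < z"
  shows "insert y (X - {z}) \<in> \<F>"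
proof -
  let ?Y = "insert y (X - {z})"
  have Xn: "X \<subseteq> {1..n}" "finite X" "card X = k"
    using sh X by (auto simp: shifted_def nsets_def)
  have "card ?Y = k"
    using Xn z y card_Suc_Diff1[of X z] by simp
  then have Y: "?Y \<in> nsets {1..n} k"
    using Xn z y by (auto simp: nsets_def)
  have "sorted_list_of_set ?Y ! i \<le> sorted_list_of_set X ! i" if i: "i < k" for i
  proof -
    let ?v = "sorted_list_of_set X ! i"
    have "card (X \<inter> {..?v}) \<le> card (?Y \<inter> {..?v})"
    proof (cases "z \<le> ?v")
      case True
      then have "?Y \<inter> {..?v} = insert y ((X \<inter> {..?v}) - {z})"
        using y by auto
      then show ?thesis
        using True z y Xn card_Suc_Diff1[of "X \<inter> {..?v}" z] by simp
    next
      case False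
      then have "X \<inter> {..?v} \<subseteq> ?Y \<inter> {..?v}" by auto
      then show ?thesis using Xn by (intro card_mono) auto
    qed
    moreover have "i < card (X \<inter> {..?v})"
      using nth_sorted_list_of_set_le_iff[of X i ?v] Xn i by simp
    ultimately show ?thesis
      using nth_sorted_list_of_set_le_iff[of ?Y i ?v] Xn i \<open>card ?Y = k\<close> by simp
  qed
  then show ?thesis
    using sh X Y unfolding shifted_def by blast
qed

section \<open>Heavy prefixes and common elements\<close>

lemma sum_card_prefix:
  fixes F :: "'i \<Rightarrow> nat set"
  assumes "finite I"
  shows "(\<Sum>i\<in>I. card (F i \<inter> {1..l})) + (\<Sum>i\<in>I. card ({1..l} - F i)) = card I * l"
proof -
  have "card (F i \<inter> {1..l}) + card ({1..l} - F i) = l" for i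
    using card_Int_Diff[of "{1..l}" "F i"] by (simp add: Int_commute)
  then show ?thesis
    by (simp add: sum.distrib[symmetric])
qed

lemma card_Inter_prefix:
  fixes F :: "'i \<Rightarrow> nat set"
  shows "card ((\<Inter>i\<in>I. F i) \<inter> {1..l}) + card (\<Union>i\<in>I. {1..l} - F i) = l"
proof -
  have "(\<Union>i\<in>I. {1..l} - F i) = {1..l} - (\<Inter>i\<in>I. F i)" by auto
  then show ?thesis
    using card_Int_Diff[of "{1..l}" "\<Inter>i\<in>I. F i"] by (simp add: Int_commute)
qed

text \<open>Passing to complements inside \<open>{1..l}\<close>, the hypothesis says that their
  sizes add up to at most \<open>l - t\<close>, so their union misses at least \<open>t\<close>
  points. Adding \<open>l\<close> on the right avoids truncated subtraction.\<close>

lemma heavy_prefix_imp_card_Inter: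
  fixes F :: "'i \<Rightarrow> nat set"
  assumes "finite I"
    and "card I * l + t \<le> (\<Sum>i\<in>I. card (F i \<inter> {1..l})) + l"
  shows "t \<le> card ((\<Inter>i\<in>I. F i) \<inter> {1..l})"
proof -
  have "card (\<Union>i\<in>I. {1..l} - F i) \<le> (\<Sum>i\<in>I. card ({1..l} - F i))"
    using assms by (intro card_UN_le) auto
  then show ?thesis
    using sum_card_prefix[OF assms(1), of F l] card_Inter_prefix[of F I l] assms(2) by linarith
qed

text \<open>
  Let \<open>z\<close> be the \<open>t\<close>-th element of the intersection. If the prefix of length \<open>z\<close> is
  not heavy enough, then some \<open>y < z\<close> is missing from two of the sets, and replacing \<open>z\<close> by \<open>y\<close>
  in one of them shrinks the intersection without changing the prefix counts from \<open>z\<close> on.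
\<close>

lemma shifted_cross_intersecting_heavy_prefix:
  assumes sh: "\<And>i. i \<in> {1..s} \<Longrightarrow> shifted n (k i) (\<F> i)"
    and ci: "cross_intersecting s t \<F>" and s: "s \<ge> 1"
    and F: "\<And>i. i \<in> {1..s} \<Longrightarrow> F i \<in> \<F> i"
  shows "\<exists>l\<le>n. t \<le> card ((\<Inter>i\<in>{1..s}. F i) \<inter> {1..l}) \<and>
           s * l + t \<le> (\<Sum>i\<in>{1..s}. card (F i \<inter> {1..l})) + l"
  using F
proof (induction "card (\<Inter>i\<in>{1..s}. F i)" arbitrary: F rule: less_induct)
  case less
  let ?I = "\<Inter>i\<in>{1..s}. F i"
  have Fn: "F i \<subseteq> {1..n}" if "i \<in> {1..s}" for i
    using sh[OF that] less.prems[OF that] by (auto simp: shifted_def nsets_def)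
  have In: "?I \<subseteq> {1..n}"
    using Fn[of 1] s by auto
  have "t \<le> card ?I"
    using ci less.prems unfolding cross_intersecting_def by blast
  moreover have "?I \<inter> {1..n} = ?I" using In by blast
  ultimately have ex: "t \<le> card (?I \<inter> {1..n})" by simp
  define z where "z = (LEAST l. t \<le> card (?I \<inter> {1..l}))"
  have zt: "t \<le> card (?I \<inter> {1..z})"
    unfolding z_def using ex by (rule LeastI)
  have zmin: "z \<le> l" if "t \<le> card (?I \<inter> {1..l})" for l
    unfolding z_def using that by (rule Least_le)
  have zn: "z \<le> n" using ex by (rule zmin)
  show ?case
  proof (cases "s * z + t \<le> (\<Sum>i\<in>{1..s}. card (F i \<inter> {1..z})) + z")
    case True
    then show ?thesis using zt zn by blast
  next
    case False
    have z0: "z > 0"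
      using False zt by (cases "z = 0") auto
    have lt: "card (?I \<inter> {1..z - 1}) < t"
      using zmin[of "z - 1"] z0 by linarith
    have split: "{1..z} = insert z {1..z - 1}" using z0 by auto
    have zI: "z \<in> ?I"
    proof (rule ccontr)
      assume "z \<notin> ?I"
      then have "?I \<inter> {1..z} = ?I \<inter> {1..z - 1}" using split by auto
      then show False using lt zt by simp
    qed
    have "?I \<inter> {1..z} = insert z (?I \<inter> {1..z - 1})" using split zI by auto
    then have "card (?I \<inter> {1..z}) \<le> Suc (card (?I \<inter> {1..z - 1}))"
      by (simp add: card_insert_if)
    then have eq: "card (?I \<inter> {1..z}) = t" using lt zt by linarith
    \<comment> \<open>If the complements in \<open>{1..z}\<close> were pairwise disjoint, the union
      bound would be an equality: their sizes would add up to exactly \<open>z - t\<close>, and the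
      prefix would be heavy after all.\<close>
    have "\<exists>i\<in>{1..s}. \<exists>i'\<in>{1..s}. i \<noteq> i' \<and> ({1..z} - F i) \<inter> ({1..z} - F i') \<noteq> {}"
    proof (rule ccontr)
      assume "\<not> ?thesis"
      then have "card (\<Union>i\<in>{1..s}. {1..z} - F i) = (\<Sum>i\<in>{1..s}. card ({1..z} - F i))"
        by (intro card_UN_disjoint) auto
      then show False
        using sum_card_prefix[of "{1..s}" F z] card_Inter_prefix[of F "{1..s}" z] eq False by simp
    qed
    then obtain a b y where ab: "a \<in> {1..s}" "b \<in> {1..s}" "a \<noteq> b"
      and y: "y \<in> {1..z}" "y \<notin> F a" "y \<notin> F b" by blast
    have za: "z \<in> F a" using zI ab by blast
    then have yz: "y < z" using y by (cases "y = z") auto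
    define G where "G = F(a := insert y (F a - {z}))"
    have Gs: "G i \<in> \<F> i" if "i \<in> {1..s}" for i
      using shifted_exchange[OF sh[OF ab(1)] less.prems[OF ab(1)] za y(2) _ yz] y(1)
        less.prems[OF that] by (auto simp: G_def)
    \<comment> \<open>Since \<open>y\<close> is also missing from \<open>F b\<close>, the new
      element does not enter the intersection.\<close>
    have GI: "(\<Inter>i\<in>{1..s}. G i) = ?I - {z}"
      using ab y yz unfolding G_def by (auto split: if_splits)
    have "card (\<Inter>i\<in>{1..s}. G i) < card ?I"
      unfolding GI using zI In by (intro card_Diff1_less) (auto intro: finite_subset)
    from less.hyps[OF this Gs] obtain l where l: "l \<le> n"
      "t \<le> card ((?I - {z}) \<inter> {1..l})"
      "s * l + t \<le> (\<Sum>i\<in>{1..s}. card (G i \<inter> {1..l})) + l"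
      unfolding GI by blast
    have "card ((?I - {z}) \<inter> {1..l}) \<le> card (?I \<inter> {1..l})"
      by (intro card_mono) auto
    then have tl: "t \<le> card (?I \<inter> {1..l})" using l by simp
    \<comment> \<open>By minimality of \<open>z\<close>, the prefix found for \<open>G\<close>
      contains both \<open>y\<close> and \<open>z\<close>, so undoing the exchange leaves its counts
      unchanged.\<close>
    then have zl: "z \<le> l" by (rule zmin)
    have "card (G i \<inter> {1..l}) = card (F i \<inter> {1..l})" if "i \<in> {1..s}" for i
    proof (cases "i = a")
      case True
      have "G a \<inter> {1..l} = insert y (F a \<inter> {1..l} - {z})"
        using y yz zl by (auto simp: G_def)
      moreover have "z \<in> F a \<inter> {1..l}" using za zl z0 by auto
      ultimately show ?thesis
        using True y yz card_Suc_Diff1[of "F a \<inter> {1..l}" z] by simp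
    qed (simp add: G_def)
    then have "(\<Sum>i\<in>{1..s}. card (G i \<inter> {1..l})) = (\<Sum>i\<in>{1..s}. card (F i \<inter> {1..l}))"
      by (intro sum.cong) auto
    then show ?thesis using l tl by auto
  qed
qed

section \<open>Counting \<open>k\<close>-subsets: moments of the hypergeometric distribution\<close>

lemma card_nsets_eq: "finite A \<Longrightarrow> card (nsets A k) = card A choose k"
proof -
  assume "finite A"
  then have "nsets A k = {B. B \<subseteq> A \<and> card B = k}"
    by (auto simp: nsets_def dest: finite_subset)
  then show ?thesis using n_subsets[OF \<open>finite A\<close>] by simp
qed

text \<open>Pascal's rule, from splitting on membership of \<open>Suc n\<close>; it drives the
  induction in \<open>sum_heavy_le\<close>.\<close>

lemma sum_nsets_Suc:
  fixes f :: "nat set \<Rightarrow> 'a::comm_monoid_add"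
  shows "sum f (nsets {1..Suc n} (Suc k)) =
           sum f (nsets {1..n} (Suc k)) + (\<Sum>F\<in>nsets {1..n} k. f (insert (Suc n) F))"
proof -
  let ?B = "insert (Suc n) ` nsets {1..n} k"
  have eq: "nsets {1..Suc n} (Suc k) = nsets {1..n} (Suc k) \<union> ?B"
  proof (intro equalityI subsetI)
    fix F assume F: "F \<in> nsets {1..Suc n} (Suc k)"
    show "F \<in> nsets {1..n} (Suc k) \<union> ?B"
    proof (cases "Suc n \<in> F")
      case True
      then have "F - {Suc n} \<in> nsets {1..n} k" "F = insert (Suc n) (F - {Suc n})"
        using F by (auto simp: nsets_def le_Suc_eq)
      then show ?thesis by blast
    next
      case False
      then show ?thesis using F by (auto simp: nsets_def le_Suc_eq)
    qed
  next
    fix F assume "F \<in> nsets {1..n} (Suc k) \<union> ?B"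
    then show "F \<in> nsets {1..Suc n} (Suc k)"
      by (auto simp: nsets_def card_insert_if)
  qed
  have inj: "inj_on (insert (Suc n)) (nsets {1..n} k)"
  proof (rule inj_onI)
    fix F G assume "F \<in> nsets {1..n} k" "G \<in> nsets {1..n} k" "insert (Suc n) F = insert (Suc n) G"
    moreover from this have "Suc n \<notin> F" "Suc n \<notin> G" by (auto simp: nsets_def)
    ultimately show "F = G" by (simp add: insert_ident)
  qed
  have "nsets {1..n} (Suc k) \<inter> ?B = {}"
    by (auto simp: nsets_def)
  then show ?thesis
    unfolding eq by (simp only: sum.union_disjoint finite_imp_finite_nsets finite_imageI finite_atLeastAtMost
        sum.reindex[OF inj] o_def)
qed

lemma nsets_superset_card:
  assumes "finite U" "A \<subseteq> U" "card A \<le> k"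
  shows "card {F \<in> nsets U k. A \<subseteq> F} = (card U - card A) choose (k - card A)"
proof -
  have fA: "finite A" using assms finite_subset by blast
  have "bij_betw (\<lambda>F. F - A) {F \<in> nsets U k. A \<subseteq> F} (nsets (U - A) (k - card A))"
  proof (rule bij_betwI[where g = "\<lambda>F. F \<union> A"])
    show "(\<lambda>F. F - A) \<in> {F \<in> nsets U k. A \<subseteq> F} \<rightarrow> nsets (U - A) (k - card A)"
      using fA by (auto simp: nsets_def card_Diff_subset)
    show "(\<lambda>F. F \<union> A) \<in> nsets (U - A) (k - card A) \<rightarrow> {F \<in> nsets U k. A \<subseteq> F}"
    proof
      fix F assume F: "F \<in> nsets (U - A) (k - card A)"
      then have "card (F \<union> A) = card F + card A"
        using fA by (intro card_Un_disjoint) (auto simp: nsets_def)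
      then show "F \<union> A \<in> {F \<in> nsets U k. A \<subseteq> F}"
        using F fA assms by (auto simp: nsets_def)
    qed
  qed (auto simp: nsets_def)
  then have "card {F \<in> nsets U k. A \<subseteq> F} = card (nsets (U - A) (k - card A))"
    by (rule bij_betw_same_card)
  then show ?thesis
    using assms fA by (simp add: card_nsets_eq card_Diff_subset)
qed

text \<open>The ratio of the two binomials is the product of \<open>(k - b) / (n - b)\<close> over
  \<open>b < a\<close>, and each factor is at most \<open>k / n\<close> because
  \<open>k \<le> n\<close>.\<close>

lemma binomial_diff_le:
  assumes "a \<le> k" "k \<le> n"
  shows "real ((n - a) choose (k - a)) \<le> (real k / real n) ^ a * real (n choose k)"
  using assms(1)
proof (induction a)
  case (Suc a)
  have na: "n - a > 0" "n > 0" using Suc.prems assms by auto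
  have "Suc (k - Suc a) * (Suc (n - Suc a) choose Suc (k - Suc a)) =
      Suc (n - Suc a) * ((n - Suc a) choose (k - Suc a))"
    by (rule Suc_times_binomial)
  moreover have "Suc (k - Suc a) = k - a" "Suc (n - Suc a) = n - a"
    using Suc.prems assms by auto
  ultimately have "real (k - a) * real ((n - a) choose (k - a)) =
      real (n - a) * real ((n - Suc a) choose (k - Suc a))"
    by (metis of_nat_mult)
  then have "real ((n - Suc a) choose (k - Suc a)) =
      real (k - a) / real (n - a) * real ((n - a) choose (k - a))"
    using na by (simp add: field_simps)
  also have "\<dots> \<le> (real k / real n) * ((real k / real n) ^ a * real (n choose k))"
  proof (rule mult_mono)
    have "real k * real a \<le> real n * real a"
      using assms by (intro mult_right_mono) auto
    moreover have "real (k - a) = real k - real a" "real (n - a) = real n - real a"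
      using Suc.prems assms by auto
    ultimately show "real (k - a) / real (n - a) \<le> real k / real n"
      using na by (simp add: divide_simps algebra_simps)
  qed (use Suc in auto)
  finally show ?case by simp
qed simp

lemma one_plus_power_card_eq_sum_Pow:
  fixes u :: real
  assumes "finite B"
  shows "(1 + u) ^ card B = (\<Sum>A\<in>Pow B. u ^ card A)"
proof -
  have "(1 + u) ^ card B = (\<Prod>x\<in>B. u + 1)"
    by (simp add: add.commute)
  also have "\<dots> = (\<Sum>A\<in>Pow B. (\<Prod>x\<in>A. u) * (\<Prod>x\<in>B - A. 1))"
    by (rule prod_add[OF assms])
  finally show ?thesis by simp
qed

text \<open>Hoeffding's comparison of the hypergeometric with the binomial generating function.\<close>

lemma sum_power_prefix_le:
  fixes u :: real
  assumes "0 \<le> u" "m \<le> n" "k \<le> n"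
  shows "(\<Sum>F\<in>nsets {1..n} k. (1 + u) ^ card (F \<inter> {1..m}))
           \<le> real (n choose k) * (1 + u * (real k / real n)) ^ m"
proof -
  let ?N = "nsets {1..n} k"
  have fN: "finite ?N" by (simp add: finite_imp_finite_nsets)
  have "(\<Sum>F\<in>?N. (1 + u) ^ card (F \<inter> {1..m}))
      = (\<Sum>F\<in>?N. \<Sum>A\<in>Pow {1..m}. if A \<subseteq> F then u ^ card A else 0)"
  proof (rule sum.cong[OF refl])
    fix F
    have "(1 + u) ^ card (F \<inter> {1..m}) = (\<Sum>A\<in>Pow (F \<inter> {1..m}). u ^ card A)"
      by (rule one_plus_power_card_eq_sum_Pow) auto
    also have "\<dots> = (\<Sum>A\<in>{A \<in> Pow {1..m}. A \<subseteq> F}. u ^ card A)"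
      by (rule sum.cong) auto
    also have "\<dots> = (\<Sum>A\<in>Pow {1..m}. if A \<subseteq> F then u ^ card A else 0)"
      by (rule sum.inter_filter) auto
    finally show "(1 + u) ^ card (F \<inter> {1..m}) = \<dots>" .
  qed
  also have "\<dots> = (\<Sum>A\<in>Pow {1..m}. \<Sum>F\<in>?N. if A \<subseteq> F then u ^ card A else 0)"
    by (rule sum.swap)
  also have "\<dots> = (\<Sum>A\<in>Pow {1..m}. real (card {F \<in> ?N. A \<subseteq> F}) * u ^ card A)"
    using fN by (intro sum.cong refl) (simp add: sum.inter_filter[symmetric])
  also have "\<dots> \<le> (\<Sum>A\<in>Pow {1..m}. real (n choose k) * (u * (real k / real n)) ^ card A)"
  proof (rule sum_mono)
    fix A assume A: "A \<in> Pow {1..m}"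
    \<comment> \<open>A random \<open>k\<close>-set contains \<open>A\<close> with at most the
      probability that independent inclusion at rate \<open>k / n\<close> would give.\<close>
    have "real (card {F \<in> ?N. A \<subseteq> F}) \<le> (real k / real n) ^ card A * real (n choose k)"
    proof (cases "card A \<le> k")
      case True
      have "A \<subseteq> {1..n}" using A assms by auto
      from nsets_superset_card[OF _ this True] show ?thesis
        using binomial_diff_le[OF True assms(3)] by simp
    next
      case False
      have "\<not> A \<subseteq> F" if "F \<in> ?N" for F
        using False that card_mono[of F A] by (auto simp: nsets_def)
      then have none: "{F \<in> ?N. A \<subseteq> F} = {}" by blast
      show ?thesis unfolding none by simp
    qed
    then have "real (card {F \<in> ?N. A \<subseteq> F}) * u ^ card A
        \<le> ((real k / real n) ^ card A * real (n choose k)) * u ^ card A"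
      using assms by (intro mult_right_mono) auto
    then show "real (card {F \<in> ?N. A \<subseteq> F}) * u ^ card A
        \<le> real (n choose k) * (u * (real k / real n)) ^ card A"
      by (simp only: power_mult_distrib mult_ac)
  qed
  also have "\<dots> = real (n choose k) * (1 + u * (real k / real n)) ^ m"
    using one_plus_power_card_eq_sum_Pow[of "{1..m}" "u * (real k / real n)"]
    by (simp add: sum_distrib_left)
  finally show ?thesis .
qed

text \<open>Double counting: each point of \<open>[n]\<close> lies in a fraction
  \<open>k / n\<close> of the \<open>k\<close>-sets.\<close>

lemma sum_card_prefix_nsets:
  assumes "m \<le> n"
  shows "real n * (\<Sum>F\<in>nsets {1..n} k. real (card (F \<inter> {1..m}))) = real m * real k * real (n choose k)"
proof -
  let ?N = "nsets {1..n} k"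
  have fN: "finite ?N" by (simp add: finite_imp_finite_nsets)
  have "(\<Sum>F\<in>?N. real (card (F \<inter> {1..m}))) = (\<Sum>F\<in>?N. \<Sum>x\<in>{1..m}. if x \<in> F then 1 else 0)"
    by (intro sum.cong refl) (simp add: sum.inter_restrict[symmetric] Int_commute)
  also have "\<dots> = (\<Sum>x\<in>{1..m}. \<Sum>F\<in>?N. if x \<in> F then 1 else 0)"
    by (rule sum.swap)
  also have "\<dots> = (\<Sum>x\<in>{1..m}. real (card {F \<in> ?N. x \<in> F}))"
    using fN by (intro sum.cong refl) (simp add: sum.inter_filter[symmetric])
  finally have *: "(\<Sum>F\<in>?N. real (card (F \<inter> {1..m}))) = (\<Sum>x\<in>{1..m}. real (card {F \<in> ?N. x \<in> F}))" .
  have "real n * real (card {F \<in> ?N. x \<in> F}) = real k * real (n choose k)" if x: "x \<in> {1..m}" for x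
  proof (cases "k = 0")
    case True
    then have "{F \<in> ?N. x \<in> F} = {}" by (auto simp: nsets_def)
    then show ?thesis using True by simp
  next
    case False
    have "card {F \<in> ?N. {x} \<subseteq> F} = (card {1..n} - card {x}) choose (k - card {x})"
      using x assms False by (intro nsets_superset_card) auto
    then have "card {F \<in> ?N. x \<in> F} = (n - 1) choose (k - 1)" by simp
    moreover have "k * (n choose k) = n * ((n - 1) choose (k - 1))"
      using x assms False by (intro times_binomial_minus1_eq) auto
    ultimately show ?thesis by (metis of_nat_mult)
  qed
  then show ?thesis
    unfolding * by (simp add: sum_distrib_left)
qed

text \<open>Jensen's inequality: \<open>card (F \<inter> {1..m})\<close> has mean
  \<open>m * k / n\<close>, which is at least \<open>\<alpha> * m\<close>, and powers of
  \<open>w\<close> are convex and increasing in the exponent.\<close>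

lemma sum_power_prefix_ge:
  fixes w \<alpha> :: real
  assumes w: "1 \<le> w" and m: "m \<le> n" "0 < n" and k: "\<alpha> * real n \<le> real k"
  shows "real (n choose k) * w powr (\<alpha> * real m)
           \<le> (\<Sum>F\<in>nsets {1..n} k. w ^ card (F \<inter> {1..m}))"
proof -
  let ?N = "nsets {1..n} k"
  define \<mu> where "\<mu> = real m * real k / real n"
  have cN: "card ?N = n choose k" by (simp add: card_nsets_eq)
  have "\<alpha> \<le> real k / real n" using k m by (simp add: field_simps)
  then have "\<alpha> * real m \<le> real k / real n * real m" by (intro mult_right_mono) auto
  then have "\<alpha> * real m \<le> \<mu>" by (simp add: \<mu>_def mult.commute)
  then have "real (n choose k) * w powr (\<alpha> * real m) \<le> real (n choose k) * w powr \<mu>"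
    using w by (intro mult_left_mono powr_mono) auto
  \<comment> \<open>The summand is the tangent of \<open>w powr x\<close> at the mean
    \<open>\<mu>\<close>; its linear term sums to zero.\<close>
  also have "\<dots> = (\<Sum>F\<in>?N. w powr \<mu> * (1 + ln w * (real (card (F \<inter> {1..m})) - \<mu>)))"
  proof -
    have "(\<Sum>F\<in>?N. real (card (F \<inter> {1..m}))) = real (n choose k) * \<mu>"
      using sum_card_prefix_nsets[OF m(1), of k] m(2) by (simp add: \<mu>_def field_simps)
    then have "(\<Sum>F\<in>?N. 1 + ln w * (real (card (F \<inter> {1..m})) - \<mu>)) = real (n choose k)"
      by (simp add: sum.distrib sum_distrib_left[symmetric] sum_subtractf cN)
    then show ?thesis by (simp add: sum_distrib_left[symmetric])
  qed
  also have "\<dots> \<le> (\<Sum>F\<in>?N. w ^ card (F \<inter> {1..m}))"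
  proof (rule sum_mono)
    fix F
    let ?x = "real (card (F \<inter> {1..m}))"
    have "w powr \<mu> * (1 + ln w * (?x - \<mu>)) \<le> w powr \<mu> * exp (ln w * (?x - \<mu>))"
      by (intro mult_left_mono exp_ge_add_one_self) auto
    also have "\<dots> = w powr ?x"
      using w by (simp add: powr_def exp_add[symmetric] algebra_simps)
    also have "\<dots> = w ^ card (F \<inter> {1..m})"
      using w by (intro powr_realpow) auto
    finally show "w powr \<mu> * (1 + ln w * (?x - \<mu>)) \<le> w ^ card (F \<inter> {1..m})" .
  qed
  finally show ?thesis .
qed

section \<open>Maximal inequality and Chernoff bound for heavy sets\<close>

text \<open>In the theorem \<open>m\<close> is the first length past the center \<open>[j]\<close>.
  No set is heavy when \<open>n < m\<close>.\<close>

definition heavy :: "nat \<Rightarrow> real \<Rightarrow> nat \<Rightarrow> nat set \<Rightarrow> bool" where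
  "heavy m \<alpha> n F \<longleftrightarrow> (\<exists>l\<in>{m..n}. \<alpha> * real l \<le> real (card (F \<inter> {1..l})))"

text \<open>
  Doob's maximal inequality for the backward martingale \<open>card (F \<inter> {1..l}) / l\<close> of a random
  \<open>k\<close>-set \<open>F\<close>: no union bound over \<open>l\<close>, which would be too lossy for small \<open>\<alpha>\<close>.
  Both sides satisfy Pascal's recursion in \<open>(n, k)\<close>.
\<close>

lemma sum_heavy_le:
  fixes w \<alpha> :: real
  assumes w: "1 \<le> w" and m: "1 \<le> m"
  shows "(\<Sum>F\<in>nsets {1..n} k. of_bool (heavy m \<alpha> n F) * w powr (\<alpha> * real m))
           \<le> (\<Sum>F\<in>nsets {1..n} k. w ^ card (F \<inter> {1..m}))"
proof (induction n arbitrary: k)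
  case 0
  have "\<not> heavy m \<alpha> 0 F" for F using m by (auto simp: heavy_def)
  then show ?case using w by (auto intro: sum_nonneg)
next
  case (Suc n)
  let ?c = "w powr (\<alpha> * real m)"
  \<comment> \<open>In the first case no length is available. In the second the full length
    \<open>Suc n\<close> already makes every \<open>k\<close>-set heavy, and Jensen's inequality
    suffices. In the third that length never qualifies, so heaviness is decided within
    \<open>{1..n}\<close>.\<close>
  consider "Suc n < m" | "m \<le> Suc n" "\<alpha> * real (Suc n) \<le> real k"
    | "m \<le> Suc n" "real k < \<alpha> * real (Suc n)" by linarith
  then show ?case
  proof cases
    case 1
    then have "\<not> heavy m \<alpha> (Suc n) F" for F by (auto simp: heavy_def)
    then show ?thesis using w by (auto intro: sum_nonneg)
  next
    case 2
    have "(\<Sum>F\<in>nsets {1..Suc n} k. of_bool (heavy m \<alpha> (Suc n) F) * ?c)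
        \<le> (\<Sum>F\<in>nsets {1..Suc n} k. ?c)"
      by (intro sum_mono) auto
    also have "\<dots> = real (Suc n choose k) * ?c"
      by (simp add: card_nsets_eq)
    also have "\<dots> \<le> (\<Sum>F\<in>nsets {1..Suc n} k. w ^ card (F \<inter> {1..m}))"
      using 2 w by (intro sum_power_prefix_ge) auto
    finally show ?thesis .
  next
    case 3
    have step: "heavy m \<alpha> (Suc n) F \<longleftrightarrow> heavy m \<alpha> n F" if "F \<in> nsets {1..Suc n} k" for F
    proof -
      have "F \<inter> {1..Suc n} = F" "card F = k" using that by (auto simp: nsets_def)
      then have "\<not> \<alpha> * real (Suc n) \<le> real (card (F \<inter> {1..Suc n}))" using 3 by simp
      then show ?thesis
        using 3(1) unfolding heavy_def by (auto simp: le_Suc_eq simp del: of_nat_Suc)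
    qed
    have LHS: "(\<Sum>F\<in>nsets {1..Suc n} k. of_bool (heavy m \<alpha> (Suc n) F) * ?c)
        = (\<Sum>F\<in>nsets {1..Suc n} k. of_bool (heavy m \<alpha> n F) * ?c)"
      using step by (intro sum.cong) auto
    show ?thesis
    proof (cases "m = Suc n")
      case True
      then have "\<not> heavy m \<alpha> n F" for F by (auto simp: heavy_def)
      then show ?thesis unfolding LHS using w by (auto intro: sum_nonneg)
    next
      case False
      then have mn: "m \<le> n" using 3 by simp
      show ?thesis
      proof (cases k)
        case k0: 0
        have "nsets {1..Suc n} 0 = nsets {1..n} 0" by (auto simp: nsets_def)
        then show ?thesis unfolding LHS using Suc.IH[of 0] k0 by simp
      next
        case k: (Suc k')
        \<comment> \<open>Prefixes up to \<open>n\<close> do not see \<open>Suc n\<close>, so after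
          Pascal's rule both sums are those for \<open>(n, k)\<close> and \<open>(n, k')\<close>,
          with \<open>k = Suc k'\<close>.\<close>
        have pre: "insert (Suc n) F \<inter> {1..l} = F \<inter> {1..l}" if "l \<le> n" for F l
          using that by auto
        then have "heavy m \<alpha> n (insert (Suc n) F) \<longleftrightarrow> heavy m \<alpha> n F" for F
          unfolding heavy_def by (intro bex_cong) (simp_all only: pre atLeastAtMost_iff)
        then show ?thesis
          unfolding LHS unfolding k sum_nsets_Suc pre[OF mn] by (simp only:) (intro add_mono Suc.IH)
      qed
    qed
  qed
qed

text \<open>Markov's inequality for \<open>w ^ card (F \<inter> {1..m})\<close> in its maximal form.
  The exponent in \<open>rate\<close> is the large deviation rate of a Poisson variable of mean
  \<open>p = k / n\<close> at \<open>\<alpha>\<close>; the hypothesis asks that \<open>m\<close>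
  times it beat \<open>p powr r\<close>.\<close>

lemma card_heavy_le:
  fixes \<alpha> r :: real
  assumes m: "1 \<le> m" and k: "0 < k" and n: "0 < n" and \<alpha>: "real k / real n \<le> \<alpha>" "\<alpha> \<le> 1"
    and rate: "r * ln (real n / real k)
       \<le> real m * (\<alpha> * ln (\<alpha> / (real k / real n)) - \<alpha> + real k / real n)"
  shows "real (card {F \<in> nsets {1..n} k. heavy m \<alpha> n F})
           \<le> (real k / real n) powr r * real (n choose k)"
proof (cases "m \<le> n")
  case False
  then have none: "{F \<in> nsets {1..n} k. heavy m \<alpha> n F} = {}" by (auto simp: heavy_def)
  show ?thesis unfolding none by simp
next
  case True
  define p where "p = real k / real n"
  have "0 < p" using k n by (simp add: p_def)
  then have p: "0 < p" "p \<le> \<alpha>" "p \<le> 1" using \<alpha> unfolding p_def by linarith+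
  have kn: "k \<le> n" using p(3) n by (simp add: p_def field_simps)
  \<comment> \<open>This choice maximizes the exponent
    \<open>\<alpha> * ln w - (w - 1) * p\<close>.\<close>
  define w where "w = \<alpha> / p"
  have w: "1 \<le> w" using p by (simp add: w_def)
  let ?N = "nsets {1..n} k"
  let ?b = "real (card {F \<in> ?N. heavy m \<alpha> n F})"
  let ?c = "w powr (\<alpha> * real m)"
  have "?b * ?c = (\<Sum>F\<in>?N. of_bool (heavy m \<alpha> n F) * ?c)"
    by (simp add: sum_distrib_right[symmetric] finite_imp_finite_nsets sum_of_bool_eq Int_def
        of_bool_def sum.inter_filter[symmetric])
  also have "\<dots> \<le> (\<Sum>F\<in>?N. (1 + (w - 1)) ^ card (F \<inter> {1..m}))"
    using sum_heavy_le[OF w m, of \<alpha> n k] by simp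
  also have "\<dots> \<le> real (n choose k) * (1 + (w - 1) * p) ^ m"
    unfolding p_def using w True kn by (intro sum_power_prefix_le) auto
  also have "\<dots> \<le> real (n choose k) * exp (real m * (\<alpha> - p))"
  proof -
    have "(w - 1) * p = \<alpha> - p" using p by (simp add: w_def field_simps)
    then have "(1 + (w - 1) * p) ^ m \<le> exp (\<alpha> - p) ^ m"
      using p exp_ge_add_one_self[of "\<alpha> - p"] by (intro power_mono) auto
    then show ?thesis
      by (intro mult_left_mono) (auto simp: exp_of_nat_mult)
  qed
  finally have "?b \<le> real (n choose k) * (exp (real m * (\<alpha> - p)) / ?c)"
    using w by (simp add: field_simps)
  also have "\<dots> \<le> real (n choose k) * p powr r"
  proof (intro mult_left_mono)
    have "exp (real m * (\<alpha> - p)) / ?c = exp (real m * (\<alpha> - p) - \<alpha> * real m * ln w)"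
      using w by (simp add: powr_def exp_diff)
    also have "\<dots> \<le> exp (r * ln p)"
    proof -
      have "ln (real n / real k) = - ln p"
        using k n by (simp add: p_def ln_div)
      then show ?thesis
        using rate by (simp add: p_def[symmetric] w_def[symmetric] algebra_simps)
    qed
    also have "\<dots> = p powr r" using p by (simp add: powr_def)
    finally show "exp (real m * (\<alpha> - p)) / ?c \<le> p powr r" .
  qed simp
  finally show ?thesis by (simp add: p_def mult.commute)
qed

section \<open>Juntas generated by light sets\<close>

text \<open>Reduces the theorem to choosing weights \<open>\<alpha> i\<close> of sum
  \<open>s - 1\<close> and bounding the number of heavy sets.\<close>

lemma juntas_of_light_sets:
  fixes \<alpha> c :: "nat \<Rightarrow> real"
  assumes s: "s \<ge> 1" and m: "m \<ge> 1"
    and sh: "\<And>i. i \<in> {1..s} \<Longrightarrow> shifted n (k i) (\<F> i)"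
    and ci: "cross_intersecting s t \<F>"
    and \<alpha>: "(\<Sum>i\<in>{1..s}. \<alpha> i) = real s - 1"
    and c: "\<And>i. i \<in> {1..s} \<Longrightarrow> real (card {F \<in> nsets {1..n} (k i). heavy m (\<alpha> i) n F}) \<le> c i"
  shows "\<exists>\<J>. (\<forall>i\<in>{1..s}. junta n (k i) {1..m - 1} (\<J> i) \<and> real (card (\<F> i - \<J> i)) \<le> c i)
           \<and> cross_intersecting s t \<J>"
proof -
  define L where "L i = {G \<in> \<F> i. \<not> heavy m (\<alpha> i) n G}" for i
  define \<J> where
    "\<J> i = {F \<in> nsets {1..n} (k i). F \<inter> {1..m - 1} \<in> (\<lambda>G. G \<inter> {1..m - 1}) ` L i}" for i
  have "junta n (k i) {1..m - 1} (\<J> i)" for i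
    unfolding junta_def \<J>_def by (intro exI[of _ "(\<lambda>G. G \<inter> {1..m - 1}) ` L i"]) auto
  moreover have "real (card (\<F> i - \<J> i)) \<le> c i" if i: "i \<in> {1..s}" for i
  proof -
    have "\<F> i - \<J> i \<subseteq> {F \<in> nsets {1..n} (k i). heavy m (\<alpha> i) n F}"
      using sh[OF i] by (auto simp: shifted_def \<J>_def L_def)
    then have "card (\<F> i - \<J> i) \<le> card {F \<in> nsets {1..n} (k i). heavy m (\<alpha> i) n F}"
      by (intro card_mono) (auto simp: finite_imp_finite_nsets)
    then show ?thesis using c[OF i] by linarith
  qed
  moreover have "cross_intersecting s t \<J>"
    unfolding cross_intersecting_def
  proof (intro allI impI)
    fix F assume F: "\<forall>i\<in>{1..s}. F i \<in> \<J> i"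
    then have "\<forall>i\<in>{1..s}. \<exists>G. G \<in> L i \<and> F i \<inter> {1..m - 1} = G \<inter> {1..m - 1}"
      by (auto simp: \<J>_def)
    then obtain G where G: "G i \<in> L i" "F i \<inter> {1..m - 1} = G i \<inter> {1..m - 1}"
      if "i \<in> {1..s}" for i
      by metis
    have "G i \<in> \<F> i" if "i \<in> {1..s}" for i
      using G(1)[OF that] by (simp add: L_def)
    from shifted_cross_intersecting_heavy_prefix[OF sh ci s this]
    obtain l where l: "l \<le> n" "s * l + t \<le> (\<Sum>i\<in>{1..s}. card (G i \<inter> {1..l})) + l" by blast
    \<comment> \<open>Otherwise lightness of every \<open>G i\<close> at length \<open>l\<close>
      gives a total below \<open>(s - 1) * l\<close>, contradicting the heavy prefix.\<close>
    have "l < m"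
    proof (rule ccontr)
      assume "\<not> l < m"
      then have "real (card (G i \<inter> {1..l})) < \<alpha> i * real l" if "i \<in> {1..s}" for i
        using G(1)[OF that] l(1) by (auto simp: L_def heavy_def not_le)
      then have "(\<Sum>i\<in>{1..s}. real (card (G i \<inter> {1..l}))) < (\<Sum>i\<in>{1..s}. \<alpha> i * real l)"
        using s by (intro sum_strict_mono) auto
      then have "real (\<Sum>i\<in>{1..s}. card (G i \<inter> {1..l})) < (real s - 1) * real l"
        by (simp add: sum_distrib_right[symmetric] \<alpha>[simplified])
      moreover have "real (s * l + t) \<le> real ((\<Sum>i\<in>{1..s}. card (G i \<inter> {1..l})) + l)"
        using l(2) by (simp only: of_nat_le_iff)
      ultimately show False by (simp add: algebra_simps)
    qed
    \<comment> \<open>The prefix lies inside the center, where \<open>F i\<close> and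
      \<open>G i\<close> agree, so it is heavy for \<open>F\<close> too.\<close>
    have "G i \<inter> {1..l} = F i \<inter> {1..l}" if "i \<in> {1..s}" for i
    proof -
      have "{1..l} = {1..m - 1} \<inter> {1..l}" using \<open>l < m\<close> by auto
      then show ?thesis using G(2)[OF that] by blast
    qed
    then have "card {1..s} * l + t \<le> (\<Sum>i\<in>{1..s}. card (F i \<inter> {1..l})) + l"
      using l(2) by simp
    then have "t \<le> card ((\<Inter>i\<in>{1..s}. F i) \<inter> {1..l})"
      by (intro heavy_prefix_imp_card_Inter) auto
    also have "\<dots> \<le> card (\<Inter>i\<in>{1..s}. F i)"
    proof (rule card_mono)
      have "finite (F 1)" using F s by (auto simp: \<J>_def nsets_def)
      then show "finite (\<Inter>i\<in>{1..s}. F i)"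
        using s by (intro finite_INT bexI[of _ 1]) auto
    qed auto
    finally show "t \<le> card (\<Inter>i\<in>{1..s}. F i)" .
  qed
  ultimately show ?thesis by blast
qed

section \<open>Estimates of the Chernoff exponent\<close>

text \<open>Apply \<open>ln y \<le> y - 1\<close> to \<open>y = sqrt (1 - x)\<close>, which lies
  below its quadratic Taylor polynomial. The quadratic gain is the source of the factor
  \<open>4 / \<epsilon>\<^sup>2\<close>.\<close>

lemma ln_one_minus_le_quadratic:
  fixes x :: real
  assumes "0 \<le> x" "x < 1"
  shows "ln (1 - x) \<le> - x - x\<^sup>2 / 4"
proof -
  have "sqrt (1 - x) \<le> 1 - x / 2 - x\<^sup>2 / 8"
  proof (rule real_le_lsqrt)
    have "x\<^sup>2 \<le> 1" using assms by (simp add: power_le_one)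
    then show "0 \<le> 1 - x / 2 - x\<^sup>2 / 8" using assms by simp
    have "(1 - x / 2 - x\<^sup>2 / 8)\<^sup>2 = 1 - x + x ^ 3 / 8 + x ^ 4 / 64"
      by (simp add: power2_eq_square power3_eq_cube power4_eq_xxxx field_simps)
    then show "1 - x \<le> (1 - x / 2 - x\<^sup>2 / 8)\<^sup>2" using assms by simp
  qed
  moreover have "ln (1 - x) = 2 * ln (sqrt (1 - x))"
    using assms by (simp add: ln_sqrt)
  moreover have "ln (sqrt (1 - x)) \<le> sqrt (1 - x) - 1"
    using assms by (intro ln_le_minus_one) auto
  ultimately show ?thesis by simp
qed

text \<open>
  With \<open>q = (1 - \<epsilon>) * \<alpha>\<close>, the first bound on \<open>m\<close> settles the case \<open>p = q\<close>, and the second one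
  says that the slack grows as \<open>p\<close> decreases.
\<close>

lemma rate_bound:
  fixes p \<alpha> \<epsilon> r m :: real
  assumes \<epsilon>: "0 < \<epsilon>" "\<epsilon> < 1" and p: "0 < p" "p \<le> (1 - \<epsilon>) * \<alpha>" and r: "0 < r"
    and m1: "4 / (\<epsilon>\<^sup>2 * \<alpha>) * (r * ln (1 / ((1 - \<epsilon>) * \<alpha>))) \<le> m" and m2: "r / (\<epsilon> * \<alpha>) \<le> m"
  shows "r * ln (1 / p) \<le> m * (\<alpha> * ln (\<alpha> / p) - \<alpha> + p)"
proof -
  define q where "q = (1 - \<epsilon>) * \<alpha>"
  have q: "0 < q" "p \<le> q" using p by (auto simp: q_def)
  have \<alpha>: "0 < \<alpha>" using q \<epsilon> by (simp add: q_def zero_less_mult_iff)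
  have m: "0 < m" using m2 \<epsilon> \<alpha> r by (meson divide_pos_pos less_le_trans mult_pos_pos)
  define x where "x = ln (q / p)"
  have x: "0 \<le> x" using q p by (simp add: x_def)
  have lnp: "ln (1 / p) = x + ln (1 / q)"
    using q p by (simp add: x_def ln_div)
  have lna: "ln (\<alpha> / p) = x - ln (1 - \<epsilon>)"
    using q p \<alpha> \<epsilon> by (simp add: x_def q_def ln_div ln_mult)
  \<comment> \<open>Convexity of \<open>exp\<close> gives \<open>q - p \<le> q * x\<close>, which
    leaves \<open>(\<alpha> - q) * x = \<epsilon> * \<alpha> * x\<close> of the term
    \<open>\<alpha> * x\<close>.\<close>
  have "q * (1 - x) \<le> q * exp (- x)"
    using q exp_ge_add_one_self[of "- x"] by (intro mult_left_mono) auto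
  also have "q * exp (- x) = p" using q p by (simp add: x_def exp_minus)
  finally have "\<epsilon> * \<alpha> * x \<le> \<alpha> * x - q + p" by (simp add: q_def algebra_simps)
  moreover have "\<alpha> * ln (1 - \<epsilon>) \<le> \<alpha> * (- \<epsilon> - \<epsilon>\<^sup>2 / 4)"
    using \<alpha> \<epsilon> by (intro mult_left_mono ln_one_minus_le_quadratic) auto
  ultimately have "\<epsilon> * \<alpha> * x + \<alpha> * \<epsilon>\<^sup>2 / 4 \<le> \<alpha> * ln (\<alpha> / p) - \<alpha> + p"
    unfolding lna by (simp add: q_def algebra_simps)
  then have "m * (\<epsilon> * \<alpha> * x + \<alpha> * \<epsilon>\<^sup>2 / 4) \<le> m * (\<alpha> * ln (\<alpha> / p) - \<alpha> + p)"
    using m by (intro mult_left_mono) auto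
  moreover have "r * x \<le> m * (\<epsilon> * \<alpha>) * x"
    using m2 \<epsilon> \<alpha> x by (intro mult_right_mono) (auto simp: field_simps)
  moreover have "r * ln (1 / q) \<le> m * (\<alpha> * \<epsilon>\<^sup>2 / 4)"
  proof -
    have "r * ln (1 / q) = 4 / (\<epsilon>\<^sup>2 * \<alpha>) * (r * ln (1 / q)) * (\<alpha> * \<epsilon>\<^sup>2 / 4)"
      using \<epsilon> \<alpha> by (simp add: field_simps)
    also have "\<dots> \<le> m * (\<alpha> * \<epsilon>\<^sup>2 / 4)"
      using m1 \<alpha> by (intro mult_right_mono) (auto simp: q_def)
    finally show ?thesis .
  qed
  ultimately show ?thesis
    unfolding lnp by (simp add: algebra_simps)
qed

text \<open>The bound \<open>2 * (exp 1)\<^sup>2 \<le> 1 / p\<close> gives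
  \<open>ln (1 / p) \<ge> ln 2 + 2\<close>, and replacing \<open>1 / p\<close> by
  \<open>\<alpha> / p\<close> costs at most \<open>ln 2\<close>. So
  \<open>ln (\<alpha> / p) - 1\<close> keeps at least a third of \<open>ln (1 / p)\<close>, matching
  the 3 in \<open>m\<close>.\<close>

lemma rate_bound_sparse:
  fixes p r m :: real
  assumes s: "s \<ge> 2" and p: "0 < p" "p \<le> 1 / (2 * (exp 1)\<^sup>2)" and r: "0 < r"
    and m: "3 * real s * r \<le> m"
  defines "\<alpha> \<equiv> (real s - 1) / real s"
  shows "r * ln (1 / p) \<le> m * (\<alpha> * ln (\<alpha> / p) - \<alpha> + p)"
proof -
  have \<alpha>: "1 / 2 \<le> \<alpha>" using s by (simp add: \<alpha>_def field_simps)
  define l where "l = ln (1 / p)"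
  have "2 * (exp 1)\<^sup>2 \<le> 1 / p"
    using p by (simp add: field_simps)
  then have "ln (2 * (exp 1)\<^sup>2) \<le> l"
    unfolding l_def using p by (subst ln_le_cancel_iff) auto
  then have l: "ln 2 + 2 \<le> l" by (simp add: ln_mult ln_realpow)
  have "ln (1 / 2) \<le> ln \<alpha>" using \<alpha> by (subst ln_le_cancel_iff) auto
  then have la: "l - ln 2 \<le> ln (\<alpha> / p)"
    using p \<alpha> by (simp add: l_def ln_div)
  have "r * l \<le> r * (3 * (l - ln 2 - 1))"
    using l ln_2_less_1 r by (intro mult_left_mono) auto
  also have "\<dots> = 3 * r * 1 * (l - ln 2 - 1)" by simp
  also have "\<dots> \<le> 3 * r * (real s - 1) * (ln (\<alpha> / p) - 1)"
    using s r l la by (intro mult_mono) auto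
  also have "\<dots> = 3 * real s * r * (\<alpha> * (ln (\<alpha> / p) - 1))"
    using s by (simp add: \<alpha>_def)
  also have "\<dots> \<le> m * (\<alpha> * (ln (\<alpha> / p) - 1) + p)"
  proof (rule mult_mono)
    show "0 \<le> m" using r by (intro order_trans[OF _ m]) simp
  qed (use m p \<alpha> l la in auto)
  finally show ?thesis by (simp add: l_def algebra_simps)
qed

text \<open>The weight \<open>k i / \<sigma>\<close> may exceed 1 when the \<open>k i\<close> are
  unbalanced. Then nothing is heavy, as a prefix of length \<open>l\<close> holds at most
  \<open>l\<close> elements; otherwise \<open>rate_bound\<close> applies.\<close>

lemma card_heavy_le_gap:
  fixes \<alpha> \<epsilon> r :: real
  assumes \<epsilon>: "0 < \<epsilon>" "\<epsilon> < 1" and r: "0 < r" and n: "0 < n" and k: "0 < k"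
    and p: "real k / real n \<le> (1 - \<epsilon>) * \<alpha>" and m: "1 \<le> m"
    and m1: "4 / (\<epsilon>\<^sup>2 * \<alpha>) * (r * ln (1 / ((1 - \<epsilon>) * \<alpha>))) \<le> real m"
    and m2: "r / (\<epsilon> * \<alpha>) \<le> real m"
  shows "real (card {F \<in> nsets {1..n} k. heavy m \<alpha> n F})
           \<le> (real k / real n) powr r * real (n choose k)"
proof (cases "\<alpha> \<le> 1")
  case True
  have p0: "0 < real k / real n" using k n by simp
  then have "0 < (1 - \<epsilon>) * \<alpha>" using p by linarith
  then have "0 < \<alpha>" using \<epsilon> by (simp add: zero_less_mult_iff)
  then have "(1 - \<epsilon>) * \<alpha> \<le> \<alpha>" using \<epsilon> by (simp add: algebra_simps)
  then show ?thesis
    using rate_bound[OF \<epsilon> p0 p r m1 m2] True p k n m by (intro card_heavy_le) auto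
next
  case False
  have "\<not> heavy m \<alpha> n F" for F
  proof
    assume "heavy m \<alpha> n F"
    then obtain l where l: "m \<le> l" "\<alpha> * real l \<le> real (card (F \<inter> {1..l}))"
      by (auto simp: heavy_def)
    have "card (F \<inter> {1..l}) \<le> card {1..l}" by (intro card_mono) auto
    then have "\<alpha> * real l \<le> 1 * real l" using l by simp
    then show False using False l m by (simp add: mult_le_cancel_right)
  qed
  then show ?thesis by simp
qed

section \<open>The three parameter ranges\<close>

theorem theorem3p6:
  fixes s t n :: nat and \<epsilon> r j \<sigma> :: real
    and k :: "nat \<Rightarrow> nat" and \<F> :: "nat \<Rightarrow> nat set set"
  assumes "s \<ge> 2" and "t \<ge> 1"
    and "0 < \<epsilon>" and "\<epsilon> \<le> 1 / 3" and "r > 0"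
    and "\<And>i. i \<in> {1..s} \<Longrightarrow> k i > 0"
    and "\<And>i. i \<in> {1..s} \<Longrightarrow> shifted n (k i) (\<F> i)"
    and "cross_intersecting s t \<F>"
    and "\<sigma> = (\<Sum>i\<in>{1..s}. real (k i) / (real s - 1))"
    and "(j = (MAX i\<in>{1..s}.
                 max (4 * \<sigma> / (\<epsilon>\<^sup>2 * real (k i)) *
                        (r * ln (\<sigma> / ((1 - \<epsilon>) * real (k i))) + ln (8 / \<epsilon>\<^sup>2)))
                     (\<sigma> * r / (\<epsilon> * real (k i))))
            \<and> real n \<ge> inverse (1 - \<epsilon>) * \<sigma>)
       \<or> (j = max (8 / \<epsilon>\<^sup>2 *
                     (r * ln (real s / ((real s - 1) * (1 - \<epsilon>))) + ln (8 / \<epsilon>\<^sup>2)))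
                  (r * real s / (\<epsilon> * (real s - 1)))
            \<and> real n \<ge> (MAX i\<in>{1..s}. inverse (1 - \<epsilon>) * (real s / (real s - 1)) * real (k i)))
       \<or> (j = 3 * real s * r
            \<and> real n \<ge> 2 * (exp 1)\<^sup>2 * real (MAX i\<in>{1..s}. k i))"
  shows "\<exists>\<J> :: nat \<Rightarrow> nat set set.
           (\<forall>i\<in>{1..s}. junta n (k i) (upto_real j) (\<J> i)
              \<and> real (card (\<F> i - \<J> i)) \<le> (real (k i) / real n) powr r * real (n choose k i))
           \<and> cross_intersecting s t \<J>"
proof -
  note s = assms(1) and \<epsilon> = assms(3,4) and r = assms(5) and kpos = assms(6)
    and sh = assms(7) and ci = assms(8) and \<sigma> = assms(9)
  \<comment> \<open>Rounding up past \<open>j\<close> makes \<open>{1..m - 1}\<close> the center and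
    keeps every lower bound on \<open>j\<close> valid for \<open>m\<close>.\<close>
  define m where "m = nat \<lfloor>j\<rfloor> + 1"
  have m: "1 \<le> m" "{1..m - 1} = upto_real j" by (auto simp: m_def upto_real_def)
  have jm: "x \<le> real m" if "x \<le> j" for x
    using that unfolding m_def by linarith
  define N where "N i = (real (k i) / real n) powr r * real (n choose k i)" for i
  have ln8: "0 \<le> ln (8 / \<epsilon>\<^sup>2)"
  proof -
    have "\<epsilon>\<^sup>2 \<le> 1" using \<epsilon> by (simp add: power_le_one)
    then show ?thesis using \<epsilon> by simp
  qed
  have ex: ?thesis
    if "(\<Sum>i\<in>{1..s}. \<alpha> i) = real s - 1"
      and "\<And>i. i \<in> {1..s} \<Longrightarrow> real (card {F \<in> nsets {1..n} (k i). heavy m (\<alpha> i) n F}) \<le> N i"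
    for \<alpha>
    using juntas_of_light_sets[OF _ m(1) sh ci that] s unfolding m(2) N_def by auto
  consider
      (i) "j = (MAX i\<in>{1..s}.
                 max (4 * \<sigma> / (\<epsilon>\<^sup>2 * real (k i)) *
                        (r * ln (\<sigma> / ((1 - \<epsilon>) * real (k i))) + ln (8 / \<epsilon>\<^sup>2)))
                     (\<sigma> * r / (\<epsilon> * real (k i))))" "real n \<ge> inverse (1 - \<epsilon>) * \<sigma>"
    | (ii) "j = max (8 / \<epsilon>\<^sup>2 *
                     (r * ln (real s / ((real s - 1) * (1 - \<epsilon>))) + ln (8 / \<epsilon>\<^sup>2)))
                  (r * real s / (\<epsilon> * (real s - 1)))"
        "real n \<ge> (MAX i\<in>{1..s}. inverse (1 - \<epsilon>) * (real s / (real s - 1)) * real (k i))"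
    | (iii) "j = 3 * real s * r" "real n \<ge> 2 * (exp 1)\<^sup>2 * real (MAX i\<in>{1..s}. k i)"
    using assms(10) by blast
  then show ?thesis
  proof cases
    case i
    have \<sigma>0: "0 < \<sigma>"
      unfolding \<sigma> using s kpos by (intro sum_pos) auto
    have n: "0 < n" "\<sigma> \<le> (1 - \<epsilon>) * real n"
    proof -
      show *: "\<sigma> \<le> (1 - \<epsilon>) * real n" using i(2) \<epsilon> by (simp add: field_simps)
      show "0 < n" using \<sigma>0 * by (cases n) auto
    qed
    show ?thesis
    proof (rule ex)
      have "(\<Sum>i\<in>{1..s}. real (k i) / \<sigma>) = (\<Sum>i\<in>{1..s}. real (k i)) / \<sigma>"
        by (simp add: sum_divide_distrib)
      also have "(\<Sum>i\<in>{1..s}. real (k i)) = (real s - 1) * \<sigma>"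
        using s by (simp add: \<sigma> sum_divide_distrib[symmetric])
      finally show "(\<Sum>i\<in>{1..s}. real (k i) / \<sigma>) = real s - 1" using \<sigma>0 by simp
    next
      fix a assume a: "a \<in> {1..s}"
      have k: "0 < k a" using kpos a .
      have "max (4 * \<sigma> / (\<epsilon>\<^sup>2 * real (k a)) *
              (r * ln (\<sigma> / ((1 - \<epsilon>) * real (k a))) + ln (8 / \<epsilon>\<^sup>2)))
            (\<sigma> * r / (\<epsilon> * real (k a))) \<le> j"
        unfolding i(1) using a by (intro Max_ge) auto
      then have j: "4 * \<sigma> / (\<epsilon>\<^sup>2 * real (k a)) *
          (r * ln (\<sigma> / ((1 - \<epsilon>) * real (k a))) + ln (8 / \<epsilon>\<^sup>2)) \<le> j"
        "\<sigma> * r / (\<epsilon> * real (k a)) \<le> j" by auto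
      have "4 * \<sigma> / (\<epsilon>\<^sup>2 * real (k a)) * (r * ln (\<sigma> / ((1 - \<epsilon>) * real (k a))))
          \<le> 4 * \<sigma> / (\<epsilon>\<^sup>2 * real (k a)) * (r * ln (\<sigma> / ((1 - \<epsilon>) * real (k a))) + ln (8 / \<epsilon>\<^sup>2))"
        using \<sigma>0 ln8 by (intro mult_left_mono) auto
      also note j(1)
      finally have "4 / (\<epsilon>\<^sup>2 * (real (k a) / \<sigma>)) * (r * ln (1 / ((1 - \<epsilon>) * (real (k a) / \<sigma>)))) \<le> real m"
        by (intro jm) simp
      moreover have "r / (\<epsilon> * (real (k a) / \<sigma>)) \<le> real m"
        using j(2) by (intro jm) (simp add: mult.commute)
      \<comment> \<open>This gap is exactly the assumption on \<open>n\<close> in this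
        range.\<close>
      moreover have "real (k a) / real n \<le> (1 - \<epsilon>) * (real (k a) / \<sigma>)"
      proof -
        have "\<sigma> * real (k a) \<le> ((1 - \<epsilon>) * real n) * real (k a)"
          using n by (intro mult_right_mono) auto
        then show ?thesis using n \<sigma>0 by (simp add: field_simps)
      qed
      ultimately show "real (card {F \<in> nsets {1..n} (k a). heavy m (real (k a) / \<sigma>) n F}) \<le> N a"
        unfolding N_def using \<epsilon> r n k m by (intro card_heavy_le_gap[where \<epsilon> = \<epsilon>]) auto
    qed
  next
    case ii
    define \<alpha> where "\<alpha> = (real s - 1) / real s"
    have \<alpha>: "1 / 2 \<le> \<alpha>" "\<alpha> \<le> 1" using s by (auto simp: \<alpha>_def field_simps)
    have "0 \<le> ln (1 / ((1 - \<epsilon>) * \<alpha>))"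
      using \<alpha> \<epsilon> by (simp add: mult_le_one)
    \<comment> \<open>The constant 8 covers \<open>4 / \<alpha>\<close>, since
      \<open>\<alpha> \<ge> 1 / 2\<close>.\<close>
    then have "4 / (\<epsilon>\<^sup>2 * \<alpha>) * (r * ln (1 / ((1 - \<epsilon>) * \<alpha>)))
        \<le> 8 / \<epsilon>\<^sup>2 * (r * ln (1 / ((1 - \<epsilon>) * \<alpha>)) + ln (8 / \<epsilon>\<^sup>2))"
      using \<alpha> \<epsilon> r ln8 by (intro mult_mono) (auto simp: field_simps)
    also have "1 / ((1 - \<epsilon>) * \<alpha>) = real s / ((real s - 1) * (1 - \<epsilon>))"
      by (simp add: \<alpha>_def mult.commute)
    finally have m1: "4 / (\<epsilon>\<^sup>2 * \<alpha>) * (r * ln (real s / ((real s - 1) * (1 - \<epsilon>)))) \<le> real m"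
      using ii(1) by (intro jm) simp
    have m2: "r / (\<epsilon> * \<alpha>) \<le> real m"
      using ii(1) by (intro jm) (simp add: \<alpha>_def)
    show ?thesis
    proof (rule ex)
      show "(\<Sum>i\<in>{1..s}. \<alpha>) = real s - 1" using s by (simp add: \<alpha>_def)
    next
      fix a assume a: "a \<in> {1..s}"
      have k: "0 < k a" using kpos a .
      have "inverse (1 - \<epsilon>) * (real s / (real s - 1)) * real (k a)
          \<le> (MAX i\<in>{1..s}. inverse (1 - \<epsilon>) * (real s / (real s - 1)) * real (k i))"
        using a by (intro Max_ge) auto
      also note ii(2)
      finally have "inverse (1 - \<epsilon>) * (real s / (real s - 1)) * real (k a) \<le> real n" .
      moreover have "inverse (1 - \<epsilon>) * (real s / (real s - 1)) * real (k a) = real (k a) / ((1 - \<epsilon>) * \<alpha>)"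
        by (simp add: \<alpha>_def field_simps)
      ultimately have kn: "real (k a) / ((1 - \<epsilon>) * \<alpha>) \<le> real n" by simp
      have d: "0 < (1 - \<epsilon>) * \<alpha>" using \<alpha> \<epsilon> by simp
      then have "real (k a) \<le> real n * ((1 - \<epsilon>) * \<alpha>)" using kn by (simp add: pos_divide_le_eq)
      moreover from this have n: "0 < n" using k by (cases n) auto
      ultimately have "real (k a) / real n \<le> (1 - \<epsilon>) * \<alpha>" by (simp add: pos_divide_le_eq mult.commute)
      then show "real (card {F \<in> nsets {1..n} (k a). heavy m \<alpha> n F}) \<le> N a"
        unfolding N_def using \<epsilon> r n k m m1 m2 \<open>1 / ((1 - \<epsilon>) * \<alpha>) = _\<close>
        by (intro card_heavy_le_gap[where \<epsilon> = \<epsilon>]) auto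
    qed
  next
    case iii
    define \<alpha> where "\<alpha> = (real s - 1) / real s"
    have \<alpha>: "1 / 2 \<le> \<alpha>" "\<alpha> \<le> 1" using s by (auto simp: \<alpha>_def field_simps)
    show ?thesis
    proof (rule ex)
      show "(\<Sum>i\<in>{1..s}. \<alpha>) = real s - 1" using s by (simp add: \<alpha>_def)
    next
      fix a assume a: "a \<in> {1..s}"
      have k: "0 < k a" using kpos a .
      have "k a \<le> (MAX i\<in>{1..s}. k i)" using a by (intro Max_ge) auto
      then have "2 * (exp 1)\<^sup>2 * real (k a) \<le> 2 * (exp 1)\<^sup>2 * real (MAX i\<in>{1..s}. k i)"
        by (intro mult_left_mono) auto
      also note iii(2)
      finally have kn: "2 * (exp 1)\<^sup>2 * real (k a) \<le> real n" .
      moreover have "0 < 2 * (exp 1)\<^sup>2 * real (k a)" using k by simp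
      ultimately have n: "0 < n" by linarith
      have p: "0 < real (k a) / real n" "real (k a) / real n \<le> 1 / (2 * (exp 1)\<^sup>2)"
        using kn n k by (auto simp: field_simps)
      have "1 \<le> (exp 1 :: real)\<^sup>2" by (simp add: one_le_power)
      then have "1 / (2 * (exp 1 :: real)\<^sup>2) \<le> 1 / 2" by (simp add: field_simps)
      then have "real (k a) / real n \<le> \<alpha>" using p \<alpha> by linarith
      moreover have "3 * real s * r \<le> real m" using iii(1) by (intro jm) simp
      from rate_bound_sparse[OF s p r this]
      have "r * ln (real n / real (k a))
          \<le> real m * (\<alpha> * ln (\<alpha> / (real (k a) / real n)) - \<alpha> + real (k a) / real n)"
        by (simp add: \<alpha>_def)
      ultimately show "real (card {F \<in> nsets {1..n} (k a). heavy m \<alpha> n F}) \<le> N a"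
        unfolding N_def using \<alpha> n k m by (intro card_heavy_le) auto
    qed
  qed
qed

end
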